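(* Let $G$ be a group and let $X,Y$ be normal subsets of $G$. Set $M=\langle X\rangle$, $N=\langle Y\rangle$, $Z:=M\cap N$. For every $m\in M$ set $X_m:=(m^{-1}X)\cap Z$ and for every $n\in N$ set $Y_n:=(n^{-1}Y)\cap Z$. Then $G=X\times Y$ if and only if the following two conditions are met: (a) $G=M\circ_Z N$. (b) $Z=X_m\times Y_n$ for every $m\in M$ and $n\in N$.
   Context: Groups may be infinite. A subset of a group $G$ is normal if it is invariant under conjugation by all elements of $G$. Set-direct product: for a group $G$ and non-empty subsets $X,Y\subseteq G$, the setwise product $XY=\{xy: x\in X,y\in Y\}$ is called direct, and is then written $X\times Y$, if both $X$ and $Y$ are normal in $G$ and every $g\in XY$ has a unique representation $g=xy$ with $x\in X$, $y\in Y$. Thus $G=X\times Y$ means that $X,Y$ are non-empty normal subsets of $G$ and every $g\in G$ is uniquely $g=xy$ with $x\in X,y\in Y$; similarly $Z=X_m\times Y_n$ is meant in the group $Z$. Central product: $G=M\circ_Z N$ means that $M,N$ are subgroups of $G$ with $G=MN$, $M$ and $N$ centralize each other, and $Z=M\cap N$ (then $M,N$ are normal and $Z$ is central in $G$). *)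

theory Defs
  imports "HOL-Algebra.Generated_Groups"
begin

definition normal_subset :: "'a set \<Rightarrow> ('a, 'b) monoid_scheme \<Rightarrow> bool" where
  "normal_subset X G \<longleftrightarrow>
     X \<subseteq> carrier G \<and> (\<forall>g\<in>carrier G. g <#\<^bsub>G\<^esub> X #>\<^bsub>G\<^esub> inv\<^bsub>G\<^esub> g = X)"

text \<open>The setwise product of \<open>X\<close> and \<open>Y\<close> is direct in \<open>G\<close>. The factors are only
  subsets, so this is weaker than an internal direct product of subgroups.\<close>

definition set_direct :: "('a, 'b) monoid_scheme \<Rightarrow> 'a set \<Rightarrow> 'a set \<Rightarrow> bool" where
  "set_direct G X Y \<longleftrightarrow>
     X \<noteq> {} \<and> Y \<noteq> {} \<and> normal_subset X G \<and> normal_subset Y G \<and>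
     (\<forall>g \<in> X <#>\<^bsub>G\<^esub> Y. \<exists>!p. p \<in> X \<times> Y \<and> g = fst p \<otimes>\<^bsub>G\<^esub> snd p)"

text \<open>\<open>G = X \<times> Y\<close>. To say this of a subgroup \<open>Z\<close> of \<open>G\<close>, apply it to
  \<open>G\<lparr>carrier := Z\<rparr>\<close>; normality is then invariance under conjugation by \<open>Z\<close>.\<close>

definition is_set_direct_product :: "('a, 'b) monoid_scheme \<Rightarrow> 'a set \<Rightarrow> 'a set \<Rightarrow> bool" where
  "is_set_direct_product G X Y \<longleftrightarrow> set_direct G X Y \<and> carrier G = X <#>\<^bsub>G\<^esub> Y"

definition is_central_product ::
  "('a, 'b) monoid_scheme \<Rightarrow> 'a set \<Rightarrow> 'a set \<Rightarrow> 'a set \<Rightarrow> bool" where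
  "is_central_product G M N Z \<longleftrightarrow>
     subgroup M G \<and> subgroup N G \<and> carrier G = M <#>\<^bsub>G\<^esub> N \<and>
     (\<forall>m\<in>M. \<forall>n\<in>N. m \<otimes>\<^bsub>G\<^esub> n = n \<otimes>\<^bsub>G\<^esub> m) \<and> Z = M \<inter> N"

end

theory Submission
  imports Defs
begin

text \<open>If \<open>G = X \<times> Y\<close>, then \<open>yx\<close> factors both as \<open>(yxy\<inverse>)y\<close> and as \<open>x(x\<inverse>yx)\<close>, so \<open>X\<close> and \<open>Y\<close>
  commute elementwise, and so do \<open>M\<close> and \<open>N\<close>. Under this commutation \<open>mnz = xy\<close> is equivalent to
  \<open>z = (m\<inverse>x)(n\<inverse>y)\<close>, and both factors lie in \<open>Z\<close> whenever the product does; this transfers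
  factorizations between \<open>G\<close> and \<open>Z\<close>. Conversely, existence for \<open>g = mn\<close> is (b) at \<open>z = 1\<close>, and
  uniqueness of \<open>xy\<close> is uniqueness of \<open>1 = 1 \<cdot> 1\<close> in \<open>X\<^sub>x \<times> Y\<^sub>y\<close>.\<close>

text \<open>Every element of \<open>X <#> Y\<close> has a factorization by definition, so unique
  existence reduces to injectivity of multiplication on pairs, a form that is easier to use and to
  establish.\<close>

lemma is_set_direct_product_iff:
  fixes G (structure)
  shows "is_set_direct_product G X Y \<longleftrightarrow>
    X \<noteq> {} \<and> Y \<noteq> {} \<and> normal_subset X G \<and> normal_subset Y G \<and> carrier G = X <#> Y \<and>
    (\<forall>x\<in>X. \<forall>y\<in>Y. \<forall>x'\<in>X. \<forall>y'\<in>Y. x \<otimes> y = x' \<otimes> y' \<longrightarrow> x = x' \<and> y = y')"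
proof -
  have "(\<forall>g \<in> X <#> Y. \<exists>!p. p \<in> X \<times> Y \<and> g = fst p \<otimes> snd p) \<longleftrightarrow>
    (\<forall>x\<in>X. \<forall>y\<in>Y. \<forall>x'\<in>X. \<forall>y'\<in>Y. x \<otimes> y = x' \<otimes> y' \<longrightarrow> x = x' \<and> y = y')" (is "?L = ?R")
  proof
    assume L: ?L
    show ?R
    proof (intro ballI impI)
      fix x y x' y' assume *: "x \<in> X" "y \<in> Y" "x' \<in> X" "y' \<in> Y" "x \<otimes> y = x' \<otimes> y'"
      then have "x \<otimes> y \<in> X <#> Y" by (auto simp: set_mult_def)
      with L have "\<exists>!p. p \<in> X \<times> Y \<and> x \<otimes> y = fst p \<otimes> snd p" by blast
      then have "(x, y) = (x', y')"
        by (rule ex1E) (metis * SigmaI fst_conv snd_conv)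
      then show "x = x' \<and> y = y'" by simp
    qed
  next
    assume R: ?R
    show ?L
    proof
      fix g assume "g \<in> X <#> Y"
      then obtain x y where "x \<in> X" "y \<in> Y" "g = x \<otimes> y" by (auto simp: set_mult_def)
      with R show "\<exists>!p. p \<in> X \<times> Y \<and> g = fst p \<otimes> snd p"
        by (intro ex1I[of _ "(x, y)"]) auto
    qed
  qed
  then show ?thesis by (auto simp: is_set_direct_product_def set_direct_def)
qed

context group
begin

lemma normal_subset_conj:
  assumes "normal_subset X G" "x \<in> X" "g \<in> carrier G"
  shows "g \<otimes> x \<otimes> inv g \<in> X"
proof -
  have "g \<otimes> x \<otimes> inv g \<in> g <# X #> inv g"
    using assms(2) by (auto simp: l_coset_def r_coset_def)
  then show ?thesis using assms(1,3) by (simp add: normal_subset_def)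
qed

text \<open>The elements commuting with \<open>a\<close> form a subgroup, so it suffices to check
  generators; the induction verifies closure under inverses and products.\<close>

lemma generate_commute1:
  assumes "X \<subseteq> carrier G" "a \<in> carrier G" "\<And>x. x \<in> X \<Longrightarrow> x \<otimes> a = a \<otimes> x"
    and "m \<in> generate G X"
  shows "m \<otimes> a = a \<otimes> m"
  using assms(4)
proof induction
  case (inv h)
  then have h: "h \<in> carrier G" "h \<otimes> a = a \<otimes> h" using assms by auto
  show ?case
    by (metis assms(2) h inv_closed inv_solve_left m_assoc m_closed r_inv r_one)
next
  case (eng h1 h2)
  then show ?case
    by (metis assms(1,2) generate_in_carrier m_assoc)
qed (use assms in auto)

text \<open>The centralizer argument is applied twice: with a generator \<open>x\<close> fixed it
  extends commutation from \<open>Y\<close> to \<open>n\<close>, then with \<open>n\<close> fixed it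
  extends from \<open>X\<close> to \<open>m\<close>.\<close>

lemma generate_commute:
  assumes "X \<subseteq> carrier G" "Y \<subseteq> carrier G"
    and "\<And>x y. x \<in> X \<Longrightarrow> y \<in> Y \<Longrightarrow> x \<otimes> y = y \<otimes> x"
    and "m \<in> generate G X" "n \<in> generate G Y"
  shows "m \<otimes> n = n \<otimes> m"
proof (rule generate_commute1[OF assms(1) _ _ assms(4)])
  show n: "n \<in> carrier G" using assms generate_in_carrier by blast
  show "x \<otimes> n = n \<otimes> x" if "x \<in> X" for x
    using generate_commute1[OF assms(2) _ _ assms(5), of x] that assms(1,3) by force
qed

lemma set_direct_product_commute:
  assumes "is_set_direct_product G X Y" "x \<in> X" "y \<in> Y"
  shows "x \<otimes> y = y \<otimes> x"
proof -
  have XY: "normal_subset X G" "normal_subset Y G"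
    and u: "\<And>x y x' y'. \<lbrakk>x \<in> X; y \<in> Y; x' \<in> X; y' \<in> Y; x \<otimes> y = x' \<otimes> y'\<rbrakk> \<Longrightarrow> x = x' \<and> y = y'"
    using assms(1) by (auto simp: is_set_direct_product_iff)
  have c: "x \<in> carrier G" "y \<in> carrier G" using XY assms by (auto simp: normal_subset_def)
  have 1: "y \<otimes> x \<otimes> inv y \<in> X" using normal_subset_conj XY assms c by blast
  have 2: "inv x \<otimes> y \<otimes> x \<in> Y"
    using normal_subset_conj[OF XY(2) assms(3), of "inv x"] c by simp
  have "(y \<otimes> x \<otimes> inv y) \<otimes> y = y \<otimes> x" using c by (simp add: m_assoc)
  also have "\<dots> = x \<otimes> (inv x \<otimes> y \<otimes> x)" using c by (simp add: m_assoc[symmetric])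
  finally have "y \<otimes> x \<otimes> inv y = x" using u[OF 1 assms(3,2) 2] by simp
  then show ?thesis using c by (metis inv_solve_right m_closed)
qed

text \<open>Moving \<open>inv n\<close> left past \<open>x\<close> collects the inverses in front.
  Their product is \<open>inv (n \<otimes> m)\<close>, and commutation of \<open>m\<close> and
  \<open>n\<close> restores the order.\<close>

lemma inv_mult_inv_mult:
  assumes "m \<in> carrier G" "x \<in> carrier G" "n \<in> carrier G" "y \<in> carrier G"
    and "m \<otimes> n = n \<otimes> m" "x \<otimes> inv n = inv n \<otimes> x"
  shows "(inv m \<otimes> x) \<otimes> (inv n \<otimes> y) = inv (m \<otimes> n) \<otimes> (x \<otimes> y)"
proof -
  have "(inv m \<otimes> x) \<otimes> (inv n \<otimes> y) = inv m \<otimes> (x \<otimes> inv n) \<otimes> y"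
    using assms(1-4) by (simp add: m_assoc)
  also have "\<dots> = (inv m \<otimes> inv n) \<otimes> (x \<otimes> y)"
    using assms(1-4) by (simp add: assms(6) m_assoc)
  also have "inv m \<otimes> inv n = inv (m \<otimes> n)"
    using assms(1,3) by (simp add: assms(5) inv_mult_group)
  finally show ?thesis .
qed

end

text \<open>Conjugation is trivial in an abelian group. Applied to \<open>Z\<close>, this settles
  the normality demanded of \<open>X_at m\<close> and \<open>Y_at n\<close>.\<close>

lemma (in comm_group) normal_subset_iff_subset:
  "normal_subset X G \<longleftrightarrow> X \<subseteq> carrier G"
proof -
  have conj: "g \<otimes> x \<otimes> inv g = x" if "g \<in> carrier G" "x \<in> carrier G" for g x
    using that m_comm[of g x] by (simp add: m_assoc)
  have "g <# X #> inv g = X" if "X \<subseteq> carrier G" "g \<in> carrier G" for g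
  proof -
    have "g <# X #> inv g = (\<lambda>x. g \<otimes> x \<otimes> inv g) ` X"
      by (auto simp: l_coset_def r_coset_def)
    also have "\<dots> = (\<lambda>x. x) ` X" using that conj by (intro image_cong) auto
    finally show ?thesis by simp
  qed
  then show ?thesis by (auto simp: normal_subset_def)
qed

theorem theorem1p2:
  fixes G :: "('a, 'b) monoid_scheme" (structure)
    and X Y M N Z :: "'a set"
    and X_at Y_at :: "'a \<Rightarrow> 'a set"
  assumes "group G"
    and "normal_subset X G" and "normal_subset Y G"
  defines "M \<equiv> generate G X"
    and "N \<equiv> generate G Y"
    and "Z \<equiv> M \<inter> N"
    and "X_at \<equiv> \<lambda>m. (inv m <# X) \<inter> Z"
    and "Y_at \<equiv> \<lambda>n. (inv n <# Y) \<inter> Z"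
  shows "is_set_direct_product G X Y \<longleftrightarrow>
    is_central_product G M N Z \<and>
    (\<forall>m\<in>M. \<forall>n\<in>N. is_set_direct_product (G\<lparr>carrier := Z\<rparr>) (X_at m) (Y_at n))"
proof -
  interpret group G by fact
  have XG: "X \<subseteq> carrier G" and YG: "Y \<subseteq> carrier G"
    using assms(2,3) by (auto simp: normal_subset_def)
  have sM: "subgroup M G" and sN: "subgroup N G"
    using XG YG by (auto simp: M_def N_def generate_is_subgroup)
  have sZ: "subgroup Z G" unfolding Z_def using sM sN by (rule subgroups_Inter_pair)
  note sub [simp] = subgroup.mem_carrier[OF sM] subgroup.mem_carrier[OF sN]
  note cl [simp] = subgroup.m_closed[OF sM] subgroup.m_closed[OF sN]
    subgroup.m_inv_closed[OF sM] subgroup.m_inv_closed[OF sN]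
  have XM [simp]: "\<And>x. x \<in> X \<Longrightarrow> x \<in> M" and YN [simp]: "\<And>y. y \<in> Y \<Longrightarrow> y \<in> N"
    by (auto simp: M_def N_def generate.incl)
  have central: "is_central_product G M N Z \<longleftrightarrow>
      carrier G = M <#> N \<and> (\<forall>m\<in>M. \<forall>n\<in>N. m \<otimes> n = n \<otimes> m)"
    using sM sN by (simp add: is_central_product_def Z_def)
  \<comment> \<open>Commutation is kept as a premise because the two directions obtain it
    differently: from uniqueness of factorizations, or from the central product.\<close>
  have shift: "(inv m \<otimes> x) \<otimes> (inv n \<otimes> y) = inv (m \<otimes> n) \<otimes> (x \<otimes> y)"
    if "\<forall>m\<in>M. \<forall>n\<in>N. m \<otimes> n = n \<otimes> m" "m \<in> M" "x \<in> M" "n \<in> N" "y \<in> N" for m x n y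
  proof (rule inv_mult_inv_mult)
    show "m \<otimes> n = n \<otimes> m" using that by blast
    show "x \<otimes> inv n = inv n \<otimes> x" using that cl(4) by blast
  qed (use that in simp_all)
  \<comment> \<open>Since \<open>Z\<close> lies in \<open>N\<close>, dividing
    \<open>a \<otimes> b\<close> by \<open>b\<close> puts \<open>a\<close> in \<open>N\<close> as
    well as in \<open>M\<close>; symmetrically for \<open>b\<close>.\<close>
  have in_Z: "a \<in> Z \<and> b \<in> Z" if "a \<in> M" "b \<in> N" "a \<otimes> b \<in> Z" for a b
  proof -
    have "a = (a \<otimes> b) \<otimes> inv b"
      using that by (simp add: m_assoc)
    moreover have "b = inv a \<otimes> (a \<otimes> b)"
      using that by (simp add: m_assoc[symmetric])
    ultimately show ?thesis using that unfolding Z_def by (metis IntD1 IntD2 IntI cl)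
  qed
  have at_iff: "a \<in> X_at m \<longleftrightarrow> a \<in> Z \<and> (\<exists>x\<in>X. a = inv m \<otimes> x)"
    "a \<in> Y_at m \<longleftrightarrow> a \<in> Z \<and> (\<exists>y\<in>Y. a = inv m \<otimes> y)" for a m
    by (auto simp: X_at_def Y_at_def l_coset_def)
  show ?thesis
  proof
    assume L: "is_set_direct_product G X Y"
    have G_eq: "carrier G = X <#> Y"
      and u: "\<And>x y x' y'. \<lbrakk>x \<in> X; y \<in> Y; x' \<in> X; y' \<in> Y; x \<otimes> y = x' \<otimes> y'\<rbrakk> \<Longrightarrow> x = x' \<and> y = y'"
      using L by (auto simp: is_set_direct_product_iff)
    have comm: "\<forall>m\<in>M. \<forall>n\<in>N. m \<otimes> n = n \<otimes> m"
      unfolding M_def N_def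
      using generate_commute[OF XG YG set_direct_product_commute[OF L]] by blast
    have "carrier G = M <#> N"
    proof
      show "carrier G \<subseteq> M <#> N"
        using mono_set_mult[of X M Y N G] G_eq by (simp add: subset_iff)
      show "M <#> N \<subseteq> carrier G"
        using sM sN by (intro setmult_subset_G) (simp_all add: subgroup.subset)
    qed
    then have a: "is_central_product G M N Z" using comm central by simp
    \<comment> \<open>An element of \<open>Z\<close> can be read as a member of \<open>M\<close> or
      of \<open>N\<close>, so commutation between \<open>M\<close> and \<open>N\<close> makes
      \<open>Z\<close> abelian.\<close>
    interpret Z: comm_group "G\<lparr>carrier := Z\<rparr>"
    proof (rule group.group_comm_groupI)
      show "group (G\<lparr>carrier := Z\<rparr>)" using sZ by (rule subgroup_imp_group)
    next
      fix a b assume "a \<in> carrier (G\<lparr>carrier := Z\<rparr>)" "b \<in> carrier (G\<lparr>carrier := Z\<rparr>)"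
      then have "a \<in> M" "b \<in> N" by (simp_all add: Z_def)
      with comm have "a \<otimes> b = b \<otimes> a" by blast
      then show "a \<otimes>\<^bsub>G\<lparr>carrier := Z\<rparr>\<^esub> b = b \<otimes>\<^bsub>G\<lparr>carrier := Z\<rparr>\<^esub> a"
        by simp
    qed
    have "is_set_direct_product (G\<lparr>carrier := Z\<rparr>) (X_at m) (Y_at n)"
      if m: "m \<in> M" and n: "n \<in> N" for m n
    proof -
      have ex: "\<exists>a\<in>X_at m. \<exists>b\<in>Y_at n. z = a \<otimes> b" if z: "z \<in> Z" for z
      proof -
        have zG: "z \<in> carrier G" using subgroup.mem_carrier[OF sZ z] .
        \<comment> \<open>Factoring \<open>m \<otimes> n \<otimes> z\<close> rather than
          \<open>z\<close> makes the factors land in the translates by \<open>inv m\<close> and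
          \<open>inv n\<close> once \<open>m \<otimes> n\<close> is divided out.\<close>
        then have "m \<otimes> n \<otimes> z \<in> X <#> Y" using m n by (simp flip: G_eq)
        then obtain x y where xy: "x \<in> X" "y \<in> Y" "m \<otimes> n \<otimes> z = x \<otimes> y"
          by (auto simp: set_mult_def)
        have z_eq: "z = (inv m \<otimes> x) \<otimes> (inv n \<otimes> y)"
          using inv_solve_left[of z "m \<otimes> n" "x \<otimes> y"] xy zG m n by (simp add: shift[OF comm])
        then have "inv m \<otimes> x \<in> Z \<and> inv n \<otimes> y \<in> Z"
          using in_Z[of "inv m \<otimes> x" "inv n \<otimes> y"] z m n xy by simp
        then have "inv m \<otimes> x \<in> X_at m" "inv n \<otimes> y \<in> Y_at n"
          using xy by (auto simp: at_iff)
        with z_eq show ?thesis by blast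
      qed
      have "\<one> \<in> Z" using subgroup.one_closed[OF sZ] .
      \<comment> \<open>A factorization of \<open>\<one>\<close> provides a member of each
        set.\<close>
      then have ne: "X_at m \<noteq> {}" "Y_at n \<noteq> {}" using ex by blast+
      have prod: "Z = X_at m <#>\<^bsub>G\<lparr>carrier := Z\<rparr>\<^esub> Y_at n"
        using ex subgroup.m_closed[OF sZ]
        by (auto simp: set_mult_def at_iff)
      have uniq: "a = a' \<and> b = b'"
        if ats: "a \<in> X_at m" "b \<in> Y_at n" "a' \<in> X_at m" "b' \<in> Y_at n"
          and eq: "a \<otimes> b = a' \<otimes> b'" for a b a' b'
      proof -
        obtain x y x' y' where xy: "x \<in> X" "y \<in> Y" "x' \<in> X" "y' \<in> Y"
          and ab: "a = inv m \<otimes> x" "b = inv n \<otimes> y" "a' = inv m \<otimes> x'" "b' = inv n \<otimes> y'"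
          using ats unfolding at_iff by blast
        \<comment> \<open>Both factorizations carry the same left factor, so cancelling it leaves an
          equation between products from \<open>X\<close> and \<open>Y\<close>, where uniqueness in
          \<open>G\<close> applies.\<close>
        have "inv (m \<otimes> n) \<otimes> (x \<otimes> y) = inv (m \<otimes> n) \<otimes> (x' \<otimes> y')"
          using eq xy m n by (simp add: ab shift[OF comm])
        then have "x \<otimes> y = x' \<otimes> y'" using xy m n by simp
        then show ?thesis using u xy ab by blast
      qed
      show ?thesis
        using ne prod uniq
        by (auto simp: is_set_direct_product_iff Z.normal_subset_iff_subset X_at_def Y_at_def)
    qed
    with a show "is_central_product G M N Z \<and>
      (\<forall>m\<in>M. \<forall>n\<in>N. is_set_direct_product (G\<lparr>carrier := Z\<rparr>) (X_at m) (Y_at n))" by blast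
  next
    assume R: "is_central_product G M N Z \<and>
      (\<forall>m\<in>M. \<forall>n\<in>N. is_set_direct_product (G\<lparr>carrier := Z\<rparr>) (X_at m) (Y_at n))"
    then have G_eq: "carrier G = M <#> N" and comm: "\<forall>m\<in>M. \<forall>n\<in>N. m \<otimes> n = n \<otimes> m"
      using central by auto
    have one: "\<one> \<in> Z" using subgroup.one_closed[OF sZ] .
    have b: "Z = X_at m <#> Y_at n"
      "\<lbrakk>a \<in> X_at m; b \<in> Y_at n; a' \<in> X_at m; b' \<in> Y_at n; a \<otimes> b = a' \<otimes> b'\<rbrakk> \<Longrightarrow> a = a' \<and> b = b'"
      if "m \<in> M" "n \<in> N" for m n a b a' b'
      using R that by (auto simp: is_set_direct_product_iff set_mult_def)
    have ex: "\<exists>x\<in>X. \<exists>y\<in>Y. g = x \<otimes> y" if "g \<in> carrier G" for g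
    proof -
      obtain m n where mn: "m \<in> M" "n \<in> N" "g = m \<otimes> n"
        using \<open>g \<in> carrier G\<close> unfolding G_eq by (auto simp: set_mult_def)
      have "\<one> \<in> X_at m <#> Y_at n" using one b(1)[OF mn(1,2)] by simp
      then obtain x y where xy: "x \<in> X" "y \<in> Y" "\<one> = (inv m \<otimes> x) \<otimes> (inv n \<otimes> y)"
        by (auto simp: set_mult_def at_iff)
      then have "\<one> = inv (m \<otimes> n) \<otimes> (x \<otimes> y)" using mn by (simp add: shift[OF comm])
      then have "g = x \<otimes> y"
        using inv_solve_left[of \<one> "m \<otimes> n" "x \<otimes> y"] mn xy(1,2) by simp
      with xy(1,2) show ?thesis by blast
    qed
    have "x = x' \<and> y = y'"
      if xy: "x \<in> X" "y \<in> Y" "x' \<in> X" "y' \<in> Y" and eq: "x \<otimes> y = x' \<otimes> y'" for x y x' y'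
    proof -
      \<comment> \<open>This is \<open>shift\<close> with the base points \<open>m = x\<close> and
        \<open>n = y\<close>; the right-hand side collapses because \<open>x' \<otimes> y'\<close>
        equals \<open>x \<otimes> y\<close>.\<close>
      have p: "(inv x \<otimes> x') \<otimes> (inv y \<otimes> y') = \<one>"
        using xy by (simp add: shift[OF comm] flip: eq)
      then have "inv x \<otimes> x' \<in> Z" "inv y \<otimes> y' \<in> Z"
        using in_Z[of "inv x \<otimes> x'" "inv y \<otimes> y'"] one xy by simp_all
      then have "inv x \<otimes> x' \<in> X_at x" "inv y \<otimes> y' \<in> Y_at y"
        using xy by (auto simp: at_iff)
      \<comment> \<open>The witnesses are \<open>x\<close> and \<open>y\<close> themselves, as
        \<open>inv x \<otimes> x = \<one>\<close>. This gives the second factorization of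
        \<open>\<one>\<close> to compare with.\<close>
      moreover have "\<one> \<in> X_at x" "\<one> \<in> Y_at y"
        using xy one by (auto simp: at_iff intro!: bexI)
      ultimately have "inv x \<otimes> x' = \<one> \<and> inv y \<otimes> y' = \<one>"
        using b(2)[of x y "inv x \<otimes> x'" "inv y \<otimes> y'" \<one> \<one>] p xy by simp
      then show ?thesis
        using inv_solve_left[of \<one> x x'] inv_solve_left[of \<one> y y'] xy by simp
    qed
    \<comment> \<open>Factoring \<open>\<one>\<close> in \<open>G\<close> supplies an element of
      each set.\<close>
    moreover have "X \<noteq> {}" "Y \<noteq> {}" using ex[OF one_closed] by auto
    moreover have "carrier G = X <#> Y"
      using ex XG YG by (auto simp: set_mult_def)
    ultimately show "is_set_direct_product G X Y"
      using assms(2,3) by (simp add: is_set_direct_product_iff)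
  qed
qed

end
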